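(* For $1\le k\le m-1$, the number of singular endomorphisms of rank $n^k$ of the Hamming graph $H(m,n)$ is $$\binom{m}{k}\cdot n^{m-k}\cdot k!\cdot\left(\sum_{\substack{P\text{ partition of }\{1,\dots,m\}\\ \text{with }k\text{ parts}}}\ \prod_{X\in P}\#\mathrm{LHC}(|X|,n)\right),$$ where the sum runs over all set partitions $P$ of $\{1,\dots,m\}$ into exactly $k$ parts, the product runs over all parts $X$ of $P$, $|X|$ is the size of the part $X$, and $\#\mathrm{LHC}(d,n)$ is the number of Latin hypercubes of dimension $d$ and order $n$ (and class $1$).
   Context: $H(m,n)$ is the graph with vertex set $\mathbb{Z}_n^m$ in which two vertices are adjacent iff they differ in exactly one coordinate. An endomorphism of a graph is a map of the vertex set to itself sending adjacent vertices to adjacent vertices; it is singular if it is not bijective; its rank is the size of its image. A Latin hypercube of dimension $d$, order $n$ and class $1$ is an $n\times\cdots\times n$ ($d$ times) array based on $n$ distinct symbols, each repeated $n^{d-1}$ times, such that every symbol occurs exactly once in each $1$-layer (line) of the array, i.e. in each set of $n$ cells obtained by fixing all coordinates but one.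
   Formalization: The formal theorem assumes n ≥ 3, or n = 2 and k = 1; the claim fails for n = 1 (the only endomorphism is bijective) and for n = 2 with 2 ≤ k ≤ m−1 (maps onto a star K_{1,3} give extra endomorphisms of rank 2^k). *)

theory Defs
  imports Main "HOL-Library.FuncSet" "HOL-Library.Disjoint_Sets"
begin

text \<open>
  The residues modulo \<open>n\<close> are represented by \<open>{..<n}\<close>; only their number matters here.
  A point of the \<open>d\<close>-dimensional cube is an extensional function on the coordinate set
  \<open>{1..d}\<close>. Maps out of cubes are extensional as well, so that counting them with
  \<^const>\<open>card\<close> counts every map exactly once.
\<close>

definition cube :: "nat \<Rightarrow> nat \<Rightarrow> (nat \<Rightarrow> nat) set" where
  "cube d n = {1..d} \<rightarrow>\<^sub>E {..<n}"

text \<open>A graph is given by a vertex set \<open>V\<close> and an adjacency relation \<open>adj\<close>.\<close>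

definition endomorphisms :: "'a set \<Rightarrow> ('a \<Rightarrow> 'a \<Rightarrow> bool) \<Rightarrow> ('a \<Rightarrow> 'a) set" where
  "endomorphisms V adj =
     {f \<in> V \<rightarrow>\<^sub>E V. \<forall>u\<in>V. \<forall>v\<in>V. adj u v \<longrightarrow> adj (f u) (f v)}"

definition singular_endomorphisms :: "'a set \<Rightarrow> ('a \<Rightarrow> 'a \<Rightarrow> bool) \<Rightarrow> ('a \<Rightarrow> 'a) set" where
  "singular_endomorphisms V adj = {f \<in> endomorphisms V adj. \<not> bij_betw f V V}"

definition map_rank :: "'a set \<Rightarrow> ('a \<Rightarrow> 'a) \<Rightarrow> nat" where
  "map_rank V f = card (f ` V)"

text \<open>The Hamming graph \<open>H(m,n)\<close> has vertex set \<^term>\<open>cube m n\<close> and the following adjacency.\<close>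

definition hamming_adj :: "nat \<Rightarrow> (nat \<Rightarrow> nat) \<Rightarrow> (nat \<Rightarrow> nat) \<Rightarrow> bool" where
  "hamming_adj m u v \<longleftrightarrow> card {i \<in> {1..m}. u i \<noteq> v i} = 1"

text \<open>The line (1-layer) through the cell \<open>x\<close> in direction \<open>i\<close>: all coordinates but \<open>i\<close> are fixed.\<close>

definition cube_line :: "nat \<Rightarrow> nat \<Rightarrow> nat \<Rightarrow> (nat \<Rightarrow> nat) \<Rightarrow> (nat \<Rightarrow> nat) set" where
  "cube_line d n i x = {y \<in> cube d n. \<forall>j\<in>{1..d} - {i}. y j = x j}"

text \<open>
  Latin hypercubes of class 1 on the fixed symbol set \<open>{..<n}\<close>: two arrays that differ by
  a renaming of the symbols are counted as different.
\<close>

definition latin_hypercubes :: "nat \<Rightarrow> nat \<Rightarrow> ((nat \<Rightarrow> nat) \<Rightarrow> nat) set" where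
  "latin_hypercubes d n =
     {L \<in> cube d n \<rightarrow>\<^sub>E {..<n}.
        (\<forall>s<n. card {x \<in> cube d n. L x = s} = n ^ (d - 1)) \<and>
        (\<forall>i\<in>{1..d}. \<forall>x\<in>cube d n. \<forall>s<n. \<exists>!y. y \<in> cube_line d n i x \<and> L y = s)}"

definition num_LHC :: "nat \<Rightarrow> nat \<Rightarrow> nat" where
  "num_LHC d n = card (latin_hypercubes d n)"

end

theory Submission
  imports Defs
begin

text \<open>
  Let \<open>f\<close> be an endomorphism of \<open>H(m,n)\<close> with \<open>n \<ge> 3\<close>. It maps each line onto a line, and
  parallel lines to parallel lines, so there is a map \<open>\<sigma>\<close> on \<open>{1..m}\<close> such that changing
  coordinate \<open>i\<close> of \<open>x\<close> changes exactly the coordinate \<open>\<sigma> i\<close> of \<open>f x\<close>. Hence the \<open>j\<close>-th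
  coordinate of \<open>f x\<close> depends only on the coordinates of \<open>x\<close> in the fibre of \<open>\<sigma>\<close> over \<open>j\<close>, and
  it is a Latin hypercube in these (a constant, if the fibre is empty). Conversely, \<open>\<sigma>\<close> and one
  Latin hypercube on each fibre can be chosen freely, and the rank is \<open>n\<close> to the power of the size of
  the image of \<open>\<sigma>\<close>. Grouping the maps \<open>\<sigma>\<close> by the partition into fibres gives the formula,
  since a partition into \<open>k\<close> parts arises from as many \<open>\<sigma>\<close> as there are injections from its parts
  into \<open>{1..m}\<close>. For \<open>n = 2\<close> and \<open>k = 1\<close> the image is a single edge, and \<open>\<sigma>\<close> is constant.
\<close>

section \<open>Points of a cube and the coordinates in which they differ\<close>

definition differ :: "'a set \<Rightarrow> ('a \<Rightarrow> 'b) \<Rightarrow> ('a \<Rightarrow> 'b) \<Rightarrow> 'a set" where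
  "differ S u v = {i \<in> S. u i \<noteq> v i}"

text \<open>Latin hypercubes with an arbitrary coordinate set, so that the fibres of
  \<open>\<sigma>\<close> can serve directly. Asking for different values along lines is enough,
  because a line has as many cells as there are symbols.\<close>

definition latin_maps :: "'a set \<Rightarrow> nat \<Rightarrow> (('a \<Rightarrow> nat) \<Rightarrow> nat) set" where
  "latin_maps S n =
     {L \<in> (S \<rightarrow>\<^sub>E {..<n}) \<rightarrow>\<^sub>E {..<n}.
        \<forall>u\<in>S \<rightarrow>\<^sub>E {..<n}. \<forall>v\<in>S \<rightarrow>\<^sub>E {..<n}. \<forall>i. differ S u v = {i} \<longrightarrow> L u \<noteq> L v}"

definition directed_maps :: "'a set \<Rightarrow> nat \<Rightarrow> ('a \<Rightarrow> 'a) \<Rightarrow> (('a \<Rightarrow> nat) \<Rightarrow> 'a \<Rightarrow> nat) set" where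
  "directed_maps I n \<sigma> =
     {f \<in> (I \<rightarrow>\<^sub>E {..<n}) \<rightarrow>\<^sub>E (I \<rightarrow>\<^sub>E {..<n}).
        \<forall>u\<in>I \<rightarrow>\<^sub>E {..<n}. \<forall>v\<in>I \<rightarrow>\<^sub>E {..<n}. \<forall>i.
          differ I u v = {i} \<longrightarrow> differ I (f u) (f v) = {\<sigma> i}}"

lemma differ_commute: "differ S u v = differ S v u"
  by (auto simp: differ_def)

lemma differ_fun_upd: "i \<in> S \<Longrightarrow> t \<noteq> u i \<Longrightarrow> differ S u (u(i := t)) = {i}"
  by (auto simp: differ_def)

lemma differ_fun_upd2: "i \<in> S \<Longrightarrow> s \<noteq> t \<Longrightarrow> differ S (u(i := s)) (u(i := t)) = {i}"
  by (auto simp: differ_def)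

lemma differ_singleton_mem: "differ S u v = {i} \<Longrightarrow> i \<in> S"
  by (auto simp: differ_def)

lemma differ_singleton_iff:
  "differ S u v = {i} \<longleftrightarrow> i \<in> S \<and> u i \<noteq> v i \<and> (\<forall>j\<in>S. j \<noteq> i \<longrightarrow> u j = v j)"
  by (auto simp: differ_def)

lemma differ_eq_upd:
  assumes "u \<in> S \<rightarrow>\<^sub>E T" "v \<in> S \<rightarrow>\<^sub>E T" "differ S u v \<subseteq> {i}"
  shows "v = u(i := v i)"
proof
  fix x show "v x = (u(i := v i)) x"
    using assms by (cases "x \<in> S") (auto simp: differ_def PiE_def extensional_def)
qed

lemma fun_upd_mem: "u \<in> S \<rightarrow>\<^sub>E T \<Longrightarrow> i \<in> S \<Longrightarrow> t \<in> T \<Longrightarrow> u(i := t) \<in> S \<rightarrow>\<^sub>E T"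
  by (auto simp: PiE_iff extensional_def)

lemma hamming_adj_iff: "hamming_adj m u v \<longleftrightarrow> (\<exists>i. differ {1..m} u v = {i})"
  by (auto simp: hamming_adj_def differ_def card_1_singleton_iff)

text \<open>One walks from \<open>u\<close> to \<open>v\<close> by overwriting one coordinate of
  \<open>D\<close> after the other with its value in \<open>v\<close>, staying in the cube
  throughout. This serves both to limit the coordinates on which a component of \<open>f\<close>
  depends and to show that directions are the same at all points.\<close>

lemma invariant_along_coordinates:
  assumes "finite D"
    and inv: "\<And>w i t. w \<in> S \<rightarrow>\<^sub>E T \<Longrightarrow> i \<in> D \<Longrightarrow> i \<in> S \<Longrightarrow> t \<in> T \<Longrightarrow> F (w(i := t)) = F w"
    and "u \<in> S \<rightarrow>\<^sub>E T" "v \<in> S \<rightarrow>\<^sub>E T" "differ S u v \<subseteq> D"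
  shows "F u = F v"
  using assms
proof (induction D arbitrary: u rule: finite_induct)
  case empty
  then have "u = v" by (auto simp: differ_def intro: PiE_ext)
  then show ?case by simp
next
  case (insert i D)
  show ?case
  proof (cases "i \<in> S")
    case True
    let ?w = "u(i := v i)"
    have v: "v i \<in> T" using True insert.prems by auto
    have "?w \<in> S \<rightarrow>\<^sub>E T" using insert.prems True v by (auto intro: fun_upd_mem)
    moreover have "differ S ?w v \<subseteq> D" using insert.prems by (auto simp: differ_def)
    ultimately have "F ?w = F v" using insert by blast
    then show ?thesis using insert.prems True v by simp
  next
    case False
    then have "differ S u v \<subseteq> D" using insert.prems by (auto simp: differ_def)
    then show ?thesis using insert by blast
  qed
qed

subsection \<open>Latin hypercubes on arbitrary coordinate sets\<close>

text \<open>The cube over the empty set is a single point, and no edge imposes a condition. This is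
  the factor \<open>n\<close> contributed by every coordinate outside the image of
  \<open>\<sigma>\<close>.\<close>

lemma latin_maps_empty: "card (latin_maps ({} :: 'a set) n) = n"
proof -
  have "latin_maps ({} :: 'a set) n = ({} \<rightarrow>\<^sub>E {..<n}) \<rightarrow>\<^sub>E {..<n}"
    by (auto simp: latin_maps_def differ_def)
  then show ?thesis by (simp add: card_funcsetE)
qed

lemma finite_latin_maps: "finite S \<Longrightarrow> finite (latin_maps S n)"
  unfolding latin_maps_def
  by (rule finite_subset[of _ "(S \<rightarrow>\<^sub>E {..<n}) \<rightarrow>\<^sub>E {..<n}"]) (auto intro!: finite_PiE)

text \<open>An injective self-map of the finite set \<open>{..<n}\<close> is onto; this recovers the
  "exactly once" of a Latin hypercube from the inequalities.\<close>

lemma latin_maps_line_bij: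
  assumes L: "L \<in> latin_maps S n" and x: "x \<in> S \<rightarrow>\<^sub>E {..<n}" and i: "i \<in> S"
  shows "bij_betw (\<lambda>t. L (x(i := t))) {..<n} {..<n}"
proof -
  have mem: "x(i := t) \<in> S \<rightarrow>\<^sub>E {..<n}" if "t < n" for t
    using x i that by (auto intro: fun_upd_mem)
  have "inj_on (\<lambda>t. L (x(i := t))) {..<n}"
  proof (rule inj_onI, rule ccontr)
    fix s t assume "s \<in> {..<n}" "t \<in> {..<n}" "L (x(i := s)) = L (x(i := t))" "s \<noteq> t"
    moreover from this have "differ S (x(i := s)) (x(i := t)) = {i}" using i by (simp add: differ_fun_upd2)
    ultimately show False using L mem unfolding latin_maps_def by blast
  qed
  moreover have "(\<lambda>t. L (x(i := t))) ` {..<n} \<subseteq> {..<n}"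
    using L mem by (fastforce simp: latin_maps_def PiE_iff)
  ultimately show ?thesis
    unfolding bij_betw_def by (simp add: endo_inj_surj)
qed

lemma latin_maps_image:
  assumes L: "L \<in> latin_maps S n" and "S \<noteq> {}" "n > 0"
  shows "L ` (S \<rightarrow>\<^sub>E {..<n}) = {..<n}"
proof
  show "L ` (S \<rightarrow>\<^sub>E {..<n}) \<subseteq> {..<n}" using L by (auto simp: latin_maps_def)
  obtain i where i: "i \<in> S" using assms by auto
  define x where "x = (\<lambda>j\<in>S. 0::nat)"
  have x: "x \<in> S \<rightarrow>\<^sub>E {..<n}" using assms by (auto simp: x_def)
  then have "{..<n} = (\<lambda>t. L (x(i := t))) ` {..<n}"
    using latin_maps_line_bij[OF L x i] by (simp add: bij_betw_def)
  also have "\<dots> \<subseteq> L ` (S \<rightarrow>\<^sub>E {..<n})" using x i by (auto intro!: imageI fun_upd_mem)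
  finally show "{..<n} \<subseteq> L ` (S \<rightarrow>\<^sub>E {..<n})" .
qed

text \<open>Every line in direction \<open>i\<close> meets the level set exactly once, so forgetting
  coordinate \<open>i\<close> maps it bijectively onto the cube over \<open>S - {i}\<close>.\<close>

lemma latin_maps_level_card:
  assumes L: "L \<in> latin_maps S n" and S: "finite S" "S \<noteq> {}" and s: "s < n"
  shows "card {x \<in> S \<rightarrow>\<^sub>E {..<n}. L x = s} = n ^ (card S - 1)"
proof -
  obtain i where i: "i \<in> S" using S by auto
  let ?A = "{x \<in> S \<rightarrow>\<^sub>E {..<n}. L x = s}" and ?B = "(S - {i}) \<rightarrow>\<^sub>E {..<n}"
  let ?r = "\<lambda>x. restrict x (S - {i})"
  have "bij_betw ?r ?A ?B"
  proof (rule bij_betwI')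
    fix x y assume x: "x \<in> ?A" and y: "y \<in> ?A"
    show "?r x = ?r y \<longleftrightarrow> x = y"
    proof
      assume eq: "?r x = ?r y"
      have "x j = y j" if "j \<in> S - {i}" for j using eq that by (metis restrict_apply')
      then have xy: "y = x(i := y i)"
        using x y by (intro differ_eq_upd[where S = S and T = "{..<n}"]) (auto simp: differ_def)
      have "inj_on (\<lambda>t. L (x(i := t))) {..<n}"
        using latin_maps_line_bij[OF L _ i, of x] x by (auto simp: bij_betw_def)
      moreover have "L (x(i := x i)) = L (x(i := y i))" using x y xy by simp
      moreover have "x i < n" "y i < n" using x y i by auto
      ultimately have "x i = y i" unfolding inj_on_def by blast
      then show "x = y" using xy by (metis fun_upd_triv)
    qed simp
  next
    fix x assume "x \<in> ?A" then show "?r x \<in> ?B" by auto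
  next
    fix z assume z: "z \<in> ?B"
    \<comment> \<open>\<open>z\<close> is undefined at \<open>i\<close>; the value 0 merely turns it
      into a point of the cube, and is admissible because \<open>s < n\<close>.\<close>
    have "z(i := 0) \<in> S \<rightarrow>\<^sub>E {..<n}" using z s i by (auto simp: PiE_iff extensional_def)
    from latin_maps_line_bij[OF L this i] have "s \<in> (\<lambda>t. L (z(i := t))) ` {..<n}"
      using s by (simp add: bij_betw_def)
    then obtain t where t: "t < n" "L (z(i := t)) = s" by auto
    moreover have "z(i := t) \<in> S \<rightarrow>\<^sub>E {..<n}" using z t i by (auto simp: PiE_iff extensional_def)
    moreover have "?r (z(i := t)) = z" using z by (intro ext) (auto simp: PiE_iff extensional_def)
    ultimately show "\<exists>x\<in>?A. z = ?r x" by (intro bexI[of _ "z(i := t)"]) auto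
  qed
  then have "card ?A = card ?B" by (rule bij_betw_same_card)
  then show ?thesis using S i by (simp add: card_funcsetE)
qed

text \<open>Two equal symbols on a line contradict uniqueness there; conversely the bijection along
  lines gives existence and uniqueness, and the level count follows. For \<open>d = 0\<close> and
  \<open>n \<ge> 2\<close> the two sides differ, since a single cell cannot hold every symbol
  once.\<close>

lemma latin_hypercubes_eq_latin_maps:
  assumes "d \<ge> 1"
  shows "latin_hypercubes d n = latin_maps {1..d} n"
proof (intro set_eqI iffI)
  fix L assume L: "L \<in> latin_hypercubes d n"
  have "L u \<noteq> L v"
    if u: "u \<in> cube d n" and v: "v \<in> cube d n" and uv: "differ {1..d} u v = {i}" for u v i
  proof
    assume eq: "L u = L v"
    have i: "i \<in> {1..d}" using uv by (rule differ_singleton_mem)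
    have "L u < n" using L u by (auto simp: latin_hypercubes_def)
    then have "\<exists>!y. y \<in> cube_line d n i u \<and> L y = L u"
      using L i u by (auto simp: latin_hypercubes_def)
    moreover have "u \<in> cube_line d n i u" "v \<in> cube_line d n i u"
      using u v uv by (auto simp: cube_line_def differ_singleton_iff)
    ultimately have "u = v" using eq by metis
    then show False using uv by (simp add: differ_singleton_iff)
  qed
  then show "L \<in> latin_maps {1..d} n"
    using L by (auto simp: latin_hypercubes_def latin_maps_def cube_def)
next
  fix L assume L: "L \<in> latin_maps {1..d} n"
  have "\<exists>!y. y \<in> cube_line d n i x \<and> L y = s"
    if i: "i \<in> {1..d}" and x: "x \<in> cube d n" and s: "s < n" for i x s
  proof -
    have x': "x \<in> {1..d} \<rightarrow>\<^sub>E {..<n}" using x by (simp add: cube_def)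
    have b: "bij_betw (\<lambda>t. L (x(i := t))) {..<n} {..<n}"
      by (rule latin_maps_line_bij[OF L x' i])
    then have "s \<in> (\<lambda>t. L (x(i := t))) ` {..<n}" using s by (simp add: bij_betw_def)
    then obtain t where t: "t < n" "L (x(i := t)) = s" by auto
    \<comment> \<open>The line through \<open>x\<close> in direction \<open>i\<close> is
      parametrised by the value of coordinate \<open>i\<close>.\<close>
    have line: "y \<in> cube_line d n i x \<longleftrightarrow> (\<exists>r<n. y = x(i := r))" for y
    proof
      assume y: "y \<in> cube_line d n i x"
      have "x j = y j" if "j \<in> {1..d}" "j \<noteq> i" for j
        using y that unfolding cube_line_def by (metis (mono_tags, lifting) DiffI mem_Collect_eq singletonD)
      then have "differ {1..d} x y \<subseteq> {i}" unfolding differ_def by blast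
      then have "y = x(i := y i)"
        using y x' by (intro differ_eq_upd) (auto simp: cube_line_def cube_def)
      moreover have "y i < n" using y i by (auto simp: cube_line_def cube_def)
      ultimately show "\<exists>r<n. y = x(i := r)" by auto
    next
      assume "\<exists>r<n. y = x(i := r)"
      then show "y \<in> cube_line d n i x"
        using x' i by (auto simp: cube_line_def cube_def intro: fun_upd_mem split: if_splits)
    qed
    show ?thesis
    proof (rule ex1I[of _ "x(i := t)"])
      show "x(i := t) \<in> cube_line d n i x \<and> L (x(i := t)) = s" using line t by auto
    next
      fix y assume y: "y \<in> cube_line d n i x \<and> L y = s"
      then obtain r where "r < n" "y = x(i := r)" using line by auto
      moreover from this have "r = t" using b t y by (auto simp: bij_betw_def dest: inj_onD)
      ultimately show "y = x(i := t)" by simp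
    qed
  qed
  moreover have "card {x \<in> cube d n. L x = s} = n ^ (d - 1)" if "s < n" for s
    using latin_maps_level_card[OF L _ _ that] assms by (simp add: cube_def)
  ultimately show "L \<in> latin_hypercubes d n"
    using L by (auto simp: latin_hypercubes_def latin_maps_def cube_def)
qed

text \<open>Composing points with \<open>h\<close> carries Latin maps over \<open>T\<close>
  injectively to Latin maps over \<open>S\<close>. An inequality suffices, since applying it to
  \<open>h\<close> and to its inverse gives equality.\<close>

lemma card_latin_maps_le:
  assumes h: "bij_betw h T S" and fin: "finite S"
  shows "card (latin_maps T n) \<le> card (latin_maps S n)"
proof (rule card_inj_on_le)
  define r where "r = (\<lambda>y::'b \<Rightarrow> nat. \<lambda>j\<in>T. y (h j))"
  define F where "F = (\<lambda>L::('a \<Rightarrow> nat) \<Rightarrow> nat. \<lambda>y\<in>S \<rightarrow>\<^sub>E {..<n}. L (r y))"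
  have hS: "h j \<in> S" if "j \<in> T" for j using h that by (auto simp: bij_betw_def)
  have r: "r y \<in> T \<rightarrow>\<^sub>E {..<n}" if "y \<in> S \<rightarrow>\<^sub>E {..<n}" for y
    using that hS by (auto simp: r_def)
  have diff: "differ T (r y) (r z) = {inv_into T h i}" if "differ S y z = {i}" for y z i
  proof -
    have i: "i \<in> S" "y i \<noteq> z i" "\<And>j. j \<in> S \<Longrightarrow> j \<noteq> i \<Longrightarrow> y j = z j"
      using that by (auto simp: differ_def)
    have "h (inv_into T h i) = i" "inv_into T h i \<in> T"
      using h i by (auto simp: bij_betw_def f_inv_into_f inv_into_into)
    moreover have "y (h j) = z (h j)" if "j \<in> T" "j \<noteq> inv_into T h i" for j
    proof -
      have "h j \<noteq> i" using h that by (auto simp: bij_betw_def)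
      then show ?thesis using i(3) hS that(1) by blast
    qed
    ultimately show ?thesis
      using i(2) by (simp add: differ_singleton_iff r_def)
  qed
  show "inj_on F (latin_maps T n)"
  proof (rule inj_onI)
    fix L M assume L: "L \<in> latin_maps T n" and M: "M \<in> latin_maps T n" and eq: "F L = F M"
    show "L = M"
    proof (rule PiE_ext)
      show "L \<in> (T \<rightarrow>\<^sub>E {..<n}) \<rightarrow>\<^sub>E {..<n}" "M \<in> (T \<rightarrow>\<^sub>E {..<n}) \<rightarrow>\<^sub>E {..<n}"
        using L M by (auto simp: latin_maps_def)
      fix x assume x: "x \<in> T \<rightarrow>\<^sub>E {..<n}"
      \<comment> \<open>The witness is \<open>x\<close> transported along the inverse of
        \<open>h\<close>, so that \<open>r y = x\<close>.\<close>
      define y where "y = (\<lambda>i\<in>S. x (inv_into T h i))"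
      have "inv_into T h i \<in> T" if "i \<in> S" for i
        using h that by (auto simp: bij_betw_def inv_into_into)
      then have y: "y \<in> S \<rightarrow>\<^sub>E {..<n}" using x by (auto simp: y_def)
      have "r y = x"
        using x h hS by (intro PiE_ext[OF r[OF y] x]) (auto simp: r_def y_def bij_betw_def)
      then show "L x = M x" using fun_cong[OF eq, of y] y by (simp add: F_def)
    qed
  qed
  show "F ` latin_maps T n \<subseteq> latin_maps S n"
  proof (rule image_subsetI)
    fix L assume L: "L \<in> latin_maps T n"
    have "F L y \<noteq> F L z"
      if "y \<in> S \<rightarrow>\<^sub>E {..<n}" "z \<in> S \<rightarrow>\<^sub>E {..<n}" "differ S y z = {i}" for y z i
      using L r diff that by (auto simp: F_def latin_maps_def)
    moreover have "F L \<in> (S \<rightarrow>\<^sub>E {..<n}) \<rightarrow>\<^sub>E {..<n}"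
      using L r unfolding F_def latin_maps_def restrict_PiE_iff by blast
    ultimately show "F L \<in> latin_maps S n" by (auto simp: latin_maps_def)
  qed
  show "finite (latin_maps S n)" using fin by (rule finite_latin_maps)
qed

lemma card_latin_maps:
  assumes S: "finite S" "S \<noteq> {}"
  shows "card (latin_maps S n) = num_LHC (card S) n"
proof -
  obtain h where h: "bij_betw h {1..card S} S"
    using S(1) ex_bij_betw_nat_finite_1 by blast
  have "card (latin_maps S n) = card (latin_maps {1..card S} n)"
    using card_latin_maps_le[OF h S(1)] card_latin_maps_le[OF bij_betw_inv_into[OF h]]
    by (simp add: le_antisym)
  moreover have "card S \<ge> 1" using S by (simp add: Suc_le_eq card_gt_0_iff)
  ultimately show ?thesis by (simp add: num_LHC_def latin_hypercubes_eq_latin_maps)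
qed

subsection \<open>Endomorphisms with prescribed directions\<close>

text \<open>The fibres are pairwise disjoint, so no coordinate of \<open>x\<close> is read by two of
  the factors \<open>g j\<close>; a factor over an empty fibre is just a constant.\<close>

definition combine ::
    "'a set \<Rightarrow> nat \<Rightarrow> ('a \<Rightarrow> 'a) \<Rightarrow> ('a \<Rightarrow> ('a \<Rightarrow> nat) \<Rightarrow> nat) \<Rightarrow> ('a \<Rightarrow> nat) \<Rightarrow> 'a \<Rightarrow> nat" where
  "combine I n \<sigma> g =
     (\<lambda>x\<in>I \<rightarrow>\<^sub>E {..<n}. \<lambda>j\<in>I. g j (restrict x {i \<in> I. \<sigma> i = j}))"

lemma latin_maps_mem: "L \<in> latin_maps S n \<Longrightarrow> x \<in> S \<rightarrow>\<^sub>E {..<n} \<Longrightarrow> L x < n"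
  unfolding latin_maps_def by blast

lemma latin_mapsD:
  "L \<in> latin_maps S n \<Longrightarrow> x \<in> S \<rightarrow>\<^sub>E {..<n} \<Longrightarrow> y \<in> S \<rightarrow>\<^sub>E {..<n} \<Longrightarrow> differ S x y = {i} \<Longrightarrow> L x \<noteq> L y"
  unfolding latin_maps_def by blast

lemma directed_maps_mem:
  "f \<in> directed_maps I n \<sigma> \<Longrightarrow> x \<in> I \<rightarrow>\<^sub>E {..<n} \<Longrightarrow> f x \<in> I \<rightarrow>\<^sub>E {..<n}"
  unfolding directed_maps_def by blast

lemma directed_mapsD:
  "f \<in> directed_maps I n \<sigma> \<Longrightarrow> x \<in> I \<rightarrow>\<^sub>E {..<n} \<Longrightarrow> y \<in> I \<rightarrow>\<^sub>E {..<n} \<Longrightarrow> differ I x y = {i}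
    \<Longrightarrow> differ I (f x) (f y) = {\<sigma> i}"
  unfolding directed_maps_def by blast

lemma restrict_mem: "x \<in> I \<rightarrow>\<^sub>E T \<Longrightarrow> J \<subseteq> I \<Longrightarrow> restrict x J \<in> J \<rightarrow>\<^sub>E T"
  by (auto simp: restrict_PiE_iff)

lemma combine_apply:
  "x \<in> I \<rightarrow>\<^sub>E {..<n} \<Longrightarrow> j \<in> I \<Longrightarrow> combine I n \<sigma> g x j = g j (restrict x {i \<in> I. \<sigma> i = j})"
  by (simp add: combine_def)

lemma combine_mem:
  assumes "g \<in> (\<Pi>\<^sub>E j\<in>I. latin_maps {i \<in> I. \<sigma> i = j} n)" "x \<in> I \<rightarrow>\<^sub>E {..<n}"
  shows "combine I n \<sigma> g x \<in> I \<rightarrow>\<^sub>E {..<n}"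
proof -
  have "g j (restrict x {i \<in> I. \<sigma> i = j}) < n" if "j \<in> I" for j
    using latin_maps_mem[OF PiE_mem[OF assms(1) that] restrict_mem[OF assms(2)]] by simp
  then show ?thesis using assms by (simp add: combine_def restrict_PiE_iff)
qed

lemma combine_funcset:
  assumes "g \<in> (\<Pi>\<^sub>E j\<in>I. latin_maps {i \<in> I. \<sigma> i = j} n)"
  shows "combine I n \<sigma> g \<in> (I \<rightarrow>\<^sub>E {..<n}) \<rightarrow>\<^sub>E (I \<rightarrow>\<^sub>E {..<n})"
  by (rule PiE_I, rule combine_mem[OF assms]) (simp_all add: combine_def)

text \<open>A change at \<open>i\<close> is invisible to every factor except the one over
  \<open>\<sigma> i\<close>, and that one must react because it is a Latin map.\<close>

lemma combine_directed:
  assumes \<sigma>: "\<sigma> ` I \<subseteq> I" and g: "g \<in> (\<Pi>\<^sub>E j\<in>I. latin_maps {i \<in> I. \<sigma> i = j} n)"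
  shows "combine I n \<sigma> g \<in> directed_maps I n \<sigma>"
proof -
  have "differ I (combine I n \<sigma> g u) (combine I n \<sigma> g v) = {\<sigma> i}"
    if u: "u \<in> I \<rightarrow>\<^sub>E {..<n}" and v: "v \<in> I \<rightarrow>\<^sub>E {..<n}" and uv: "differ I u v = {i}" for u v i
  proof -
    have i: "i \<in> I" using uv by (rule differ_singleton_mem)
    have eq: "restrict u {i \<in> I. \<sigma> i = j} = restrict v {i \<in> I. \<sigma> i = j}" if "j \<noteq> \<sigma> i" for j
      using uv that by (auto simp: differ_singleton_iff restrict_def fun_eq_iff)
    let ?F = "{k \<in> I. \<sigma> k = \<sigma> i}"
    have "differ ?F (restrict u ?F) (restrict v ?F) = {i}"
      using uv by (auto simp: differ_singleton_iff)
    moreover have "\<sigma> i \<in> I" using \<sigma> i by auto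
    then have "g (\<sigma> i) \<in> latin_maps ?F n" using g by (rule PiE_mem[rotated])
    moreover have "restrict u ?F \<in> ?F \<rightarrow>\<^sub>E {..<n}" "restrict v ?F \<in> ?F \<rightarrow>\<^sub>E {..<n}"
      using u v by (auto intro: restrict_mem)
    ultimately have "g (\<sigma> i) (restrict u ?F) \<noteq> g (\<sigma> i) (restrict v ?F)"
      by (intro latin_mapsD[where L = "g (\<sigma> i)" and S = ?F and n = n and i = i])
    then show ?thesis
      using \<sigma> i u v eq by (auto simp: differ_singleton_iff combine_apply)
  qed
  moreover have "combine I n \<sigma> g \<in> (I \<rightarrow>\<^sub>E {..<n}) \<rightarrow>\<^sub>E (I \<rightarrow>\<^sub>E {..<n})"
    using g by (rule combine_funcset)
  ultimately show ?thesis by (simp add: directed_maps_def)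
qed

section \<open>Recovering the factors from a directed map\<close>

definition pad :: "'a set \<Rightarrow> 'a set \<Rightarrow> ('a \<Rightarrow> nat) \<Rightarrow> 'a \<Rightarrow> nat" where
  "pad I J y = (\<lambda>i\<in>I. if i \<in> J then y i else 0)"

lemma pad_mem: "y \<in> J \<rightarrow>\<^sub>E {..<n} \<Longrightarrow> n > 0 \<Longrightarrow> pad I J y \<in> I \<rightarrow>\<^sub>E {..<n}"
  by (auto simp: pad_def)

lemma restrict_pad: "y \<in> J \<rightarrow>\<^sub>E {..<n} \<Longrightarrow> J \<subseteq> I \<Longrightarrow> restrict (pad I J y) J = y"
  by (rule PiE_ext[where s = "\<lambda>_. {..<n}"]) (auto simp: pad_def PiE_iff subset_iff)

text \<open>The padded point of \<open>y\<close> restricts to \<open>y\<close>, so each value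
  \<open>g j y\<close> can be read off the combined map. \<open>n > 0\<close> makes the filler 0
  available.\<close>

lemma combine_inj_on:
  assumes n: "n > 0"
  shows "inj_on (combine I n \<sigma>) (\<Pi>\<^sub>E j\<in>I. latin_maps {i \<in> I. \<sigma> i = j} n)"
proof (rule inj_onI)
  let ?P = "\<Pi>\<^sub>E j\<in>I. latin_maps {i \<in> I. \<sigma> i = j} n"
  fix g h assume g: "g \<in> ?P" and h: "h \<in> ?P" and eq: "combine I n \<sigma> g = combine I n \<sigma> h"
  show "g = h"
  proof (rule PiE_ext[OF g h])
    fix j assume j: "j \<in> I"
    let ?F = "{i \<in> I. \<sigma> i = j}"
    have "g j \<in> latin_maps ?F n" "h j \<in> latin_maps ?F n" using g h j by auto
    then have "g j \<in> (?F \<rightarrow>\<^sub>E {..<n}) \<rightarrow>\<^sub>E {..<n}" "h j \<in> (?F \<rightarrow>\<^sub>E {..<n}) \<rightarrow>\<^sub>E {..<n}"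
      by (simp_all add: latin_maps_def)
    then show "g j = h j"
    proof (rule PiE_ext)
      fix y assume y: "y \<in> ?F \<rightarrow>\<^sub>E {..<n}"
      have "combine I n \<sigma> g (pad I ?F y) j = combine I n \<sigma> h (pad I ?F y) j" by (simp add: eq)
      then show "g j y = h j y"
        using j y n by (simp add: combine_apply pad_mem restrict_pad[where n = n])
    qed
  qed
qed

text \<open>The factor over \<open>j\<close> is coordinate \<open>j\<close> of \<open>f\<close> at
  padded points. Padding loses nothing, because a change outside the fibre over \<open>j\<close>
  moves \<open>f\<close> in a coordinate other than \<open>j\<close>.\<close>

lemma combine_surj:
  assumes fin: "finite I" and n: "n > 0" and f: "f \<in> directed_maps I n \<sigma>"
  obtains g where "g \<in> (\<Pi>\<^sub>E j\<in>I. latin_maps {i \<in> I. \<sigma> i = j} n)" "f = combine I n \<sigma> g"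
proof
  define F where "F j = {i \<in> I. \<sigma> i = j}" for j
  have FI: "F j \<subseteq> I" for j by (auto simp: F_def)
  define g where "g = (\<lambda>j\<in>I. \<lambda>y\<in>F j \<rightarrow>\<^sub>E {..<n}. f (pad I (F j) y) j)"
  have "g j \<in> latin_maps (F j) n" if j: "j \<in> I" for j
  proof -
    have "f (pad I (F j) y) j < n" if "y \<in> F j \<rightarrow>\<^sub>E {..<n}" for y
      using directed_maps_mem[OF f pad_mem[OF that n]] j by auto
    then have "g j \<in> (F j \<rightarrow>\<^sub>E {..<n}) \<rightarrow>\<^sub>E {..<n}" using j by (simp add: g_def restrict_PiE_iff)
    moreover have "g j y \<noteq> g j z"
      if y: "y \<in> F j \<rightarrow>\<^sub>E {..<n}" and z: "z \<in> F j \<rightarrow>\<^sub>E {..<n}" and yz: "differ (F j) y z = {i}" for y z i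
    proof -
      have "differ I (pad I (F j) y) (pad I (F j) z) = {i}"
        using yz FI[of j] unfolding differ_singleton_iff by (auto simp: pad_def)
      then have "differ I (f (pad I (F j) y)) (f (pad I (F j) z)) = {\<sigma> i}"
        using y z n by (intro directed_mapsD[OF f] pad_mem)
      moreover have "\<sigma> i = j" using differ_singleton_mem[OF yz] by (simp add: F_def)
      ultimately show ?thesis using j y z by (simp add: g_def differ_singleton_iff)
    qed
    ultimately show ?thesis unfolding latin_maps_def by blast
  qed
  then show g: "g \<in> (\<Pi>\<^sub>E j\<in>I. latin_maps {i \<in> I. \<sigma> i = j} n)" by (simp add: g_def F_def)
  show "f = combine I n \<sigma> g"
  proof (rule PiE_ext)
    show "f \<in> (I \<rightarrow>\<^sub>E {..<n}) \<rightarrow>\<^sub>E (I \<rightarrow>\<^sub>E {..<n})" using f by (simp add: directed_maps_def)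
    show "combine I n \<sigma> g \<in> (I \<rightarrow>\<^sub>E {..<n}) \<rightarrow>\<^sub>E (I \<rightarrow>\<^sub>E {..<n})"
      using g by (rule combine_funcset)
    fix x assume x: "x \<in> I \<rightarrow>\<^sub>E {..<n}"
    show "f x = combine I n \<sigma> g x"
    proof (rule PiE_ext[OF directed_maps_mem[OF f x] combine_mem[OF g x]])
      fix j assume j: "j \<in> I"
      have r: "restrict x (F j) \<in> F j \<rightarrow>\<^sub>E {..<n}" using x FI by (rule restrict_mem)
      \<comment> \<open>The coordinates outside the fibre are replaced by 0 one at a time.\<close>
      have "f x j = f (pad I (F j) (restrict x (F j))) j"
      proof (rule invariant_along_coordinates[where D = "I - F j" and S = I and T = "{..<n}" and F = "\<lambda>u. f u j"])
        show "finite (I - F j)" using fin by simp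
        show "differ I x (pad I (F j) (restrict x (F j))) \<subseteq> I - F j"
          by (auto simp: differ_def pad_def)
        fix w i t assume w: "w \<in> I \<rightarrow>\<^sub>E {..<n}" and i: "i \<in> I - F j" and t: "t \<in> {..<n}"
        show "f (w(i := t)) j = f w j"
        proof (cases "w i = t")
          case False
          then have "differ I w (w(i := t)) = {i}" using i by (intro differ_fun_upd) auto
          then have "differ I (f w) (f (w(i := t))) = {\<sigma> i}"
            using w i t by (intro directed_mapsD[OF f] fun_upd_mem) auto
          then show ?thesis using i j by (auto simp: differ_singleton_iff F_def)
        qed auto
      qed (use x pad_mem[OF r n] in auto)
      also have "\<dots> = combine I n \<sigma> g x j"
        using x j r by (simp add: combine_apply g_def flip: F_def)
      finally show "f x j = combine I n \<sigma> g x j" .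
    qed
  qed
qed

lemma combine_bij_betw:
  assumes "finite I" "n > 0" "\<sigma> ` I \<subseteq> I"
  shows "bij_betw (combine I n \<sigma>) (\<Pi>\<^sub>E j\<in>I. latin_maps {i \<in> I. \<sigma> i = j} n) (directed_maps I n \<sigma>)"
  unfolding bij_betw_def
  using combine_inj_on[OF assms(2)] combine_directed[OF assms(3)] combine_surj[OF assms(1,2)] by blast

text \<open>A directed map amounts to a free choice of one factor for each \<open>j\<close>: one of
  \<open>n\<close> constants over an empty fibre, a Latin hypercube otherwise.\<close>

lemma card_directed_maps:
  assumes fin: "finite I" and n: "n > 0" and \<sigma>: "\<sigma> ` I \<subseteq> I"
  shows "card (directed_maps I n \<sigma>) =
    n ^ (card I - card (\<sigma> ` I)) * (\<Prod>j\<in>\<sigma> ` I. num_LHC (card {i \<in> I. \<sigma> i = j}) n)"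
proof -
  let ?c = "\<lambda>j. card (latin_maps {i \<in> I. \<sigma> i = j} n)"
  have "card (directed_maps I n \<sigma>) = (\<Prod>j\<in>I. ?c j)"
    using bij_betw_same_card[OF combine_bij_betw[OF assms]] fin by (simp add: card_PiE)
  also have "\<dots> = (\<Prod>j\<in>I - \<sigma> ` I. ?c j) * (\<Prod>j\<in>\<sigma> ` I. ?c j)"
    using \<sigma> fin by (rule prod.subset_diff)
  also have "(\<Prod>j\<in>I - \<sigma> ` I. ?c j) = (\<Prod>j\<in>I - \<sigma> ` I. n)"
  proof (rule prod.cong)
    fix j assume "j \<in> I - \<sigma> ` I"
    then have "{i \<in> I. \<sigma> i = j} = {}" by auto
    then show "?c j = n" by (simp only: latin_maps_empty)
  qed simp
  also have "\<dots> = n ^ (card I - card (\<sigma> ` I))" using fin \<sigma> by (simp add: card_Diff_subset)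
  also have "(\<Prod>j\<in>\<sigma> ` I. ?c j) = (\<Prod>j\<in>\<sigma> ` I. num_LHC (card {i \<in> I. \<sigma> i = j}) n)"
    using fin by (intro prod.cong card_latin_maps) auto
  finally show ?thesis .
qed

text \<open>The image is a box. Factors over distinct \<open>j\<close> read disjoint fibres, so
  their values are independent; a factor takes all \<open>n\<close> values over a nonempty fibre and
  a single value over an empty one.\<close>

lemma card_image_directed_map:
  assumes fin: "finite I" and n: "n > 0" and \<sigma>: "\<sigma> ` I \<subseteq> I" and f: "f \<in> directed_maps I n \<sigma>"
  shows "card (f ` (I \<rightarrow>\<^sub>E {..<n})) = n ^ card (\<sigma> ` I)"
proof -
  obtain g where g: "g \<in> (\<Pi>\<^sub>E j\<in>I. latin_maps {i \<in> I. \<sigma> i = j} n)" and f_eq: "f = combine I n \<sigma> g"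
    using combine_surj[OF fin n f] .
  define F where "F j = {i \<in> I. \<sigma> i = j}" for j
  have FI: "F j \<subseteq> I" for j by (auto simp: F_def)
  let ?im = "\<lambda>j. g j ` (F j \<rightarrow>\<^sub>E {..<n})"
  have "f ` (I \<rightarrow>\<^sub>E {..<n}) = (\<Pi>\<^sub>E j\<in>I. ?im j)"
  proof
    show "f ` (I \<rightarrow>\<^sub>E {..<n}) \<subseteq> (\<Pi>\<^sub>E j\<in>I. ?im j)"
    proof (rule image_subsetI)
      fix x assume x: "x \<in> I \<rightarrow>\<^sub>E {..<n}"
      show "f x \<in> (\<Pi>\<^sub>E j\<in>I. ?im j)"
        unfolding f_eq combine_def using x restrict_mem[OF x FI] by (simp add: restrict_PiE_iff flip: F_def)
    qed
    show "(\<Pi>\<^sub>E j\<in>I. ?im j) \<subseteq> f ` (I \<rightarrow>\<^sub>E {..<n})"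
    proof
      fix z assume z: "z \<in> (\<Pi>\<^sub>E j\<in>I. ?im j)"
      have "\<forall>j\<in>I. \<exists>y. y \<in> F j \<rightarrow>\<^sub>E {..<n} \<and> z j = g j y" by (auto dest!: PiE_mem[OF z])
      then obtain y where y: "y j \<in> F j \<rightarrow>\<^sub>E {..<n}" "z j = g j (y j)" if "j \<in> I" for j by metis
      \<comment> \<open>The preimages \<open>y j\<close> are glued: coordinate \<open>i\<close>
        comes from \<open>y (\<sigma> i)\<close>, the argument of the only factor that reads
        it.\<close>
      define x where "x = (\<lambda>i\<in>I. y (\<sigma> i) i)"
      have "y (\<sigma> i) i < n" if i: "i \<in> I" for i
      proof -
        have "\<sigma> i \<in> I" "i \<in> F (\<sigma> i)" using \<sigma> i by (auto simp: F_def)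
        then show ?thesis using y(1)[of "\<sigma> i"] by auto
      qed
      then have x: "x \<in> I \<rightarrow>\<^sub>E {..<n}" by (simp add: x_def restrict_PiE_iff)
      have r: "restrict x (F j) = y j" if j: "j \<in> I" for j
        by (rule PiE_ext[OF restrict_mem[OF x FI] y(1)[OF j]]) (auto simp: x_def F_def)
      have "z = f x"
      proof
        fix j show "z j = f x j"
        proof (cases "j \<in> I")
          case True
          then show ?thesis using x y r by (simp add: f_eq combine_apply flip: F_def)
        next
          case False
          then show ?thesis using z x by (simp add: f_eq combine_def PiE_arb[OF z])
        qed
      qed
      then show "z \<in> f ` (I \<rightarrow>\<^sub>E {..<n})" using x by blast
    qed
  qed
  then have "card (f ` (I \<rightarrow>\<^sub>E {..<n})) = (\<Prod>j\<in>I. card (?im j))" using fin by (simp add: card_PiE)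
  also have "\<dots> = (\<Prod>j\<in>I. if j \<in> \<sigma> ` I then n else 1)"
  proof (rule prod.cong)
    fix j assume j: "j \<in> I"
    show "card (?im j) = (if j \<in> \<sigma> ` I then n else 1)"
    proof (cases "j \<in> \<sigma> ` I")
      case True
      then have "F j \<noteq> {}" by (auto simp: F_def)
      moreover have "g j \<in> latin_maps (F j) n" using g j by (auto simp: F_def)
      ultimately show ?thesis using True n by (simp add: latin_maps_image)
    next
      case False
      then have "F j = {}" by (auto simp: F_def)
      then show ?thesis using False by simp
    qed
  qed simp
  also have "\<dots> = (\<Prod>j\<in>\<sigma> ` I. n)"
    using \<sigma> fin by (simp add: prod.inter_restrict[symmetric] Int_absorb1)
  finally show ?thesis by simp
qed

subsection \<open>Every endomorphism has directions\<close>

text \<open>If \<open>a\<close> and \<open>b\<close> were different, \<open>y\<close> and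
  \<open>z\<close> would disagree in both of these coordinates.\<close>

lemma differ_triangle:
  assumes "differ S x y = {a}" "differ S x z = {b}" "differ S y z = {c}"
  shows "a = b"
  using assms unfolding differ_singleton_iff by metis

text \<open>
  Two lines with different directions cannot be matched pointwise by edges once each carries three
  points: a matched pair agrees in coordinate \<open>a\<close> or in coordinate \<open>b\<close>, and each of the two
  agreements occurs for at most one pair.
\<close>

lemma no_transversal_lines:
  assumes p: "differ S p0 p1 = {a}" "differ S p0 p2 = {a}" "differ S p1 p2 = {a}"
    and q: "differ S q0 q1 = {b}" "differ S q0 q2 = {b}" "differ S q1 q2 = {b}"
    and pq: "differ S p0 q0 = {e0}" "differ S p1 q1 = {e1}" "differ S p2 q2 = {e2}"
  shows "a = b"
proof (rule ccontr)
  assume ab: "a \<noteq> b"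
  have S: "a \<in> S" "b \<in> S" using p(1) q(1) by (auto intro: differ_singleton_mem)
  have "p0 a = q0 a \<or> p0 b = q0 b" "p1 a = q1 a \<or> p1 b = q1 b" "p2 a = q2 a \<or> p2 b = q2 b"
    using pq S ab unfolding differ_singleton_iff by metis+
  moreover have "p0 b = p1 b" "p0 b = p2 b" "q0 a = q1 a" "q0 a = q2 a"
    using p q S ab unfolding differ_singleton_iff by auto
  moreover have "p0 a \<noteq> p1 a" "p0 a \<noteq> p2 a" "p1 a \<noteq> p2 a" "q0 b \<noteq> q1 b" "q0 b \<noteq> q2 b" "q1 b \<noteq> q2 b"
    using p q unfolding differ_singleton_iff by auto
  ultimately show False by metis
qed

text \<open>Triangles force a common direction along a line, \<open>no_transversal_lines\<close>
  carries it to neighbouring parallel lines, and a walk through the cube leaves it dependent on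
  \<open>i\<close> only. The passage to a parallel line uses three points on each line, hence
  \<open>n \<ge> 3\<close>.\<close>

lemma adjacency_preserving_directed:
  assumes fin: "finite I" and n: "n \<ge> 3"
    and f: "f \<in> (I \<rightarrow>\<^sub>E {..<n}) \<rightarrow>\<^sub>E (I \<rightarrow>\<^sub>E {..<n})"
    and adj: "\<And>u v i. u \<in> I \<rightarrow>\<^sub>E {..<n} \<Longrightarrow> v \<in> I \<rightarrow>\<^sub>E {..<n} \<Longrightarrow> differ I u v = {i} \<Longrightarrow>
      \<exists>j. differ I (f u) (f v) = {j}"
  shows "\<exists>\<sigma>\<in>I \<rightarrow>\<^sub>E I. f \<in> directed_maps I n \<sigma>"
proof -
  let ?V = "I \<rightarrow>\<^sub>E {..<n}"
  \<comment> \<open>The direction at \<open>u\<close> is read from one reference edge, whose other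
    end has 0 in coordinate \<open>i\<close>, or 1 if \<open>u i\<close> is already 0.\<close>
  define \<delta> where "\<delta> i u = the_elem (differ I (f u) (f (u(i := if u i = 0 then 1 else 0))))" for i u
  have dir: "differ I (f u) (f v) = {\<delta> i u}" if u: "u \<in> ?V" and v: "v \<in> ?V" and uv: "differ I u v = {i}" for u v i
  proof -
    define s where "s = (if u i = 0 then 1 else 0 :: nat)"
    have s: "s \<noteq> u i" "s < n" using n by (auto simp: s_def)
    have i: "i \<in> I" using uv by (rule differ_singleton_mem)
    let ?w = "u(i := s)"
    have w: "?w \<in> ?V" using u i s by (auto intro: fun_upd_mem)
    have uw: "differ I u ?w = {i}" using i s by (intro differ_fun_upd)
    obtain b where b: "differ I (f u) (f ?w) = {b}" using adj[OF u w uw] by blast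
    then have \<delta>: "\<delta> i u = b" by (simp add: \<delta>_def flip: s_def)
    obtain a where a: "differ I (f u) (f v) = {a}" using adj[OF u v uv] by blast
    have vu: "v = u(i := v i)" using u v uv by (intro differ_eq_upd) auto
    show ?thesis
    proof (cases "v i = s")
      case True
      then show ?thesis using vu b \<delta> by simp
    next
      \<comment> \<open>\<open>u\<close>, \<open>v\<close> and the reference neighbour are pairwise
        adjacent, hence so are their images, and such a triangle has a single direction.\<close>
      case False
      then have "differ I (u(i := v i)) ?w = {i}" using i by (intro differ_fun_upd2)
      then have "differ I v ?w = {i}" using vu by simp
      then obtain c where "differ I (f v) (f ?w) = {c}" using adj[OF v w] by blast
      then have "a = b" using a b by (rule differ_triangle[rotated 2])
      then show ?thesis using a \<delta> by simp
    qed
  qed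
  have same: "\<delta> i u = \<delta> i v" if "u \<in> ?V" "v \<in> ?V" "differ I u v = {i}" for u v i
  proof -
    \<comment> \<open>The edge between \<open>u\<close> and \<open>v\<close>, read from either end,
      gives the direction at both.\<close>
    have "{\<delta> i u} = {\<delta> i v}"
      using dir[OF that] dir[OF that(2,1)] that(3) by (simp add: differ_commute[of I])
    then show ?thesis by simp
  qed
  have step: "\<delta> i (u(k := r)) = \<delta> i u" if u: "u \<in> ?V" and k: "k \<in> I" and r: "r < n" and i: "i \<in> I" for i u k r
  proof (cases "r = u k")
    case False
    let ?u' = "u(k := r)"
    have u': "?u' \<in> ?V" using u k r by (auto intro: fun_upd_mem)
    have uu': "differ I u ?u' = {k}" using k False by (intro differ_fun_upd)
    show ?thesis
    proof (cases "k = i")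
      case True
      then show ?thesis using same u u' uu' by metis
    next
      case False
      \<comment> \<open>A ladder: two parallel lines in direction \<open>i\<close>, whose points
        with equal \<open>t\<close> are joined by rungs in direction \<open>k\<close>.\<close>
      let ?x = "\<lambda>t. u(i := t)" and ?y = "\<lambda>t. ?u'(i := t)"
      have line: "differ I (f (w(i := s))) (f (w(i := t))) = {\<delta> i w}"
        if w: "w \<in> ?V" and st: "s < n" "t < n" "s \<noteq> t" for w s t
      proof -
        have ws: "w(i := s) \<in> ?V" and wt: "w(i := t) \<in> ?V" using w i st by (auto intro: fun_upd_mem)
        have "\<delta> i (w(i := s)) = \<delta> i w"
        proof (cases "s = w i")
          case False
          then have "differ I w (w(i := s)) = {i}" using i by (intro differ_fun_upd)
          then show ?thesis using same w ws by metis
        qed auto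
        moreover have "differ I (w(i := s)) (w(i := t)) = {i}" using i st by (intro differ_fun_upd2)
        ultimately show ?thesis using dir[OF ws wt] by simp
      qed
      have rungs: "\<exists>e. differ I (f (?x t)) (f (?y t)) = {e}" if "t < n" for t
      proof (rule adj)
        show "?x t \<in> ?V" "?y t \<in> ?V" using fun_upd_mem[OF u i] fun_upd_mem[OF u' i] that by simp_all
        show "differ I (?x t) (?y t) = {k}" using uu' False by (auto simp: differ_singleton_iff)
      qed
      have n3: "0 < n" "1 < n" "2 < n" using n by auto
      obtain e0 e1 e2 where "differ I (f (?x 0)) (f (?y 0)) = {e0}"
        "differ I (f (?x 1)) (f (?y 1)) = {e1}" "differ I (f (?x 2)) (f (?y 2)) = {e2}"
        using rungs n3 by meson
      then have "\<delta> i u = \<delta> i ?u'"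
        using line[OF u] line[OF u'] n3
        by (intro no_transversal_lines[of I "f (?x 0)" "f (?x 1)" "\<delta> i u" "f (?x 2)"
              "f (?y 0)" "f (?y 1)" "\<delta> i ?u'" "f (?y 2)" e0 e1 e2]) simp_all
      then show ?thesis by simp
    qed
  qed simp
  define z where "z = (\<lambda>i\<in>I. 0 :: nat)"
  have z: "z \<in> ?V" using n by (auto simp: z_def)
  have const: "\<delta> i u = \<delta> i z" if "i \<in> I" "u \<in> ?V" for i u
  proof (rule invariant_along_coordinates[OF fin, where S = I and T = "{..<n}" and F = "\<delta> i"])
    show "\<delta> i (w(k := t)) = \<delta> i w" if "w \<in> I \<rightarrow>\<^sub>E {..<n}" "k \<in> I" "t \<in> {..<n}" for w k t
      using step[OF that(1,2) _ \<open>i \<in> I\<close>] that(3) by simp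
    show "differ I u z \<subseteq> I" by (auto simp: differ_def)
  qed (use that z in auto)
  define \<sigma> where "\<sigma> = (\<lambda>i\<in>I. \<delta> i z)"
  have dir\<sigma>: "differ I (f u) (f v) = {\<sigma> i}" if "u \<in> ?V" "v \<in> ?V" "differ I u v = {i}" for u v i
    using dir[OF that] const[OF differ_singleton_mem[OF that(3)] that(1)] differ_singleton_mem[OF that(3)]
    by (simp add: \<sigma>_def)
  have "\<sigma> i \<in> I" if i: "i \<in> I" for i
  proof -
    \<comment> \<open>The edge at the origin in direction \<open>i\<close> shows that
      \<open>\<sigma> i\<close> is one of the coordinates.\<close>
    have "z(i := 1) \<in> ?V" using z i n by (auto intro: fun_upd_mem)
    moreover have "differ I z (z(i := 1)) = {i}" using i by (intro differ_fun_upd) (auto simp: z_def)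
    ultimately show ?thesis using dir\<sigma>[OF z] differ_singleton_mem by metis
  qed
  then have "\<sigma> \<in> I \<rightarrow>\<^sub>E I" by (simp add: \<sigma>_def restrict_PiE_iff)
  moreover have "f \<in> directed_maps I n \<sigma>" using f dir\<sigma> unfolding directed_maps_def by blast
  ultimately show ?thesis by blast
qed

text \<open>With only two image points, adjacency forces every edge onto the same pair
  \<open>{a, b}\<close>, so one direction serves for all edges. The element \<open>i\<close>
  guarantees an edge from which to read it.\<close>

lemma adjacency_preserving_rank_2_directed:
  assumes n: "n \<ge> 2" and i: "i \<in> I"
    and f: "f \<in> (I \<rightarrow>\<^sub>E {..<n}) \<rightarrow>\<^sub>E (I \<rightarrow>\<^sub>E {..<n})"
    and adj: "\<And>u v i. u \<in> I \<rightarrow>\<^sub>E {..<n} \<Longrightarrow> v \<in> I \<rightarrow>\<^sub>E {..<n} \<Longrightarrow> differ I u v = {i} \<Longrightarrow>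
      \<exists>j. differ I (f u) (f v) = {j}"
    and rank: "card (f ` (I \<rightarrow>\<^sub>E {..<n})) = 2"
  shows "\<exists>\<sigma>\<in>I \<rightarrow>\<^sub>E I. f \<in> directed_maps I n \<sigma>"
proof -
  let ?V = "I \<rightarrow>\<^sub>E {..<n}"
  obtain a b where im: "f ` ?V = {a, b}" using rank by (auto simp: card_2_iff)
  have edge: "{f u, f v} = {a, b} \<and> f u \<noteq> f v"
    if "u \<in> ?V" "v \<in> ?V" "differ I u v = {k}" for u v k
  proof -
    have "f u \<noteq> f v" using adj[OF that] by (auto simp: differ_def)
    moreover have "f u \<in> {a, b}" "f v \<in> {a, b}" using im that(1,2) by blast+
    ultimately show ?thesis by auto
  qed
  define z where "z = (\<lambda>i\<in>I. 0 :: nat)"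
  have z: "z \<in> ?V" using n by (auto simp: z_def)
  have z1: "z(i := 1) \<in> ?V" using z i n by (auto intro: fun_upd_mem)
  have zz1: "differ I z (z(i := 1)) = {i}" using i by (intro differ_fun_upd) (auto simp: z_def)
  obtain j where j: "differ I (f z) (f (z(i := 1))) = {j}" using adj[OF z z1 zz1] by blast
  have "differ I (f u) (f v) = {j}" if "u \<in> ?V" "v \<in> ?V" "differ I u v = {k}" for u v k
  proof -
    have "{f u, f v} = {f z, f (z(i := 1))}" using edge[OF that] edge[OF z z1 zz1] by simp
    \<comment> \<open>The pair may occur in reversed order, which \<open>differ\<close> does not
      notice.\<close>
    then show ?thesis using j by (metis doubleton_eq_iff differ_commute)
  qed
  then have "differ I (f u) (f v) = {(\<lambda>_\<in>I. j) k}"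
    if "u \<in> ?V" "v \<in> ?V" "differ I u v = {k}" for u v k
    using that differ_singleton_mem[OF that(3)] by simp
  then have "f \<in> directed_maps I n (\<lambda>_\<in>I. j)" using f unfolding directed_maps_def by blast
  moreover have "(\<lambda>_\<in>I. j) \<in> I \<rightarrow>\<^sub>E I" using differ_singleton_mem[OF j] by simp
  ultimately show ?thesis by blast
qed

text \<open>\<open>\<sigma> i\<close> is visible on the edge at the origin in direction
  \<open>i\<close>, which exists as \<open>n \<ge> 2\<close>. This makes the classes for different
  \<open>\<sigma>\<close> disjoint.\<close>

lemma directed_maps_unique:
  assumes n: "n \<ge> 2" and \<sigma>: "\<sigma> \<in> I \<rightarrow>\<^sub>E I" and \<tau>: "\<tau> \<in> I \<rightarrow>\<^sub>E I"
    and f: "f \<in> directed_maps I n \<sigma>" "f \<in> directed_maps I n \<tau>"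
  shows "\<sigma> = \<tau>"
proof (rule PiE_ext[OF \<sigma> \<tau>])
  fix i assume i: "i \<in> I"
  define z where "z = (\<lambda>i\<in>I. 0 :: nat)"
  have z: "z \<in> I \<rightarrow>\<^sub>E {..<n}" using n by (auto simp: z_def)
  have z1: "z(i := 1) \<in> I \<rightarrow>\<^sub>E {..<n}" using z i n by (auto intro: fun_upd_mem)
  have "differ I z (z(i := 1)) = {i}" using i by (intro differ_fun_upd) (auto simp: z_def)
  then show "\<sigma> i = \<tau> i" using directed_mapsD[OF f(1) z z1] directed_mapsD[OF f(2) z z1] by simp
qed

subsection \<open>Maps with a given kernel\<close>

text \<open>An injection on \<open>S\<close> extends to one more element by any value not yet taken,
  and the number of these values is the same for all injections. The product form vanishes when
  \<open>T\<close> is too small and is the one that enters the final formula.\<close>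

lemma card_injections:
  assumes "finite S" "finite T"
  shows "card {f \<in> S \<rightarrow>\<^sub>E T. inj_on f S} = fact (card S) * (card T choose card S)"
  using assms(1)
proof (induction S rule: finite_induct)
  case empty
  have "{f \<in> {} \<rightarrow>\<^sub>E T. inj_on f {}} = {\<lambda>_. undefined}" by auto
  then show ?case by simp
next
  case (insert x S)
  let ?A = "{f \<in> S \<rightarrow>\<^sub>E T. inj_on f S}"
  have finA: "finite ?A"
    using insert assms(2) by (intro finite_subset[of ?A "S \<rightarrow>\<^sub>E T"] finite_PiE) auto
  have "bij_betw (\<lambda>(g, y). g(x := y)) (SIGMA g:?A. T - g ` S) {f \<in> insert x S \<rightarrow>\<^sub>E T. inj_on f (insert x S)}"
  proof (rule bij_betwI[where g = "\<lambda>f. (restrict f S, f x)"])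
    show "(\<lambda>(g, y). g(x := y)) \<in> (SIGMA g:?A. T - g ` S) \<rightarrow> {f \<in> insert x S \<rightarrow>\<^sub>E T. inj_on f (insert x S)}"
    proof
      fix p assume "p \<in> (SIGMA g:?A. T - g ` S)"
      then obtain g y where p: "p = (g, y)" "g \<in> S \<rightarrow>\<^sub>E T" "inj_on g S" "y \<in> T" "y \<notin> g ` S" by auto
      have "inj_on (g(x := y)) S" using p by (auto intro: inj_on_fun_updI)
      moreover have "(g(x := y)) ` S = g ` S" using insert(2) by auto
      ultimately have "inj_on (g(x := y)) (insert x S)" using p insert(2) by simp
      then show "(case p of (g, y) \<Rightarrow> g(x := y)) \<in> {f \<in> insert x S \<rightarrow>\<^sub>E T. inj_on f (insert x S)}"
        using p by (simp add: PiE_fun_upd)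
    qed
    show "(\<lambda>f. (restrict f S, f x)) \<in> {f \<in> insert x S \<rightarrow>\<^sub>E T. inj_on f (insert x S)} \<rightarrow> (SIGMA g:?A. T - g ` S)"
      using insert(2) by (auto simp: inj_on_def restrict_PiE_iff)
    show "(\<lambda>f. (restrict f S, f x)) ((\<lambda>(g, y). g(x := y)) p) = p" if "p \<in> (SIGMA g:?A. T - g ` S)" for p
      using that insert(2) by (auto simp: fun_eq_iff PiE_iff extensional_def)
    show "(\<lambda>(g, y). g(x := y)) ((\<lambda>f. (restrict f S, f x)) f) = f"
      if "f \<in> {f \<in> insert x S \<rightarrow>\<^sub>E T. inj_on f (insert x S)}" for f
      using that by (auto simp: fun_eq_iff PiE_iff extensional_def)
  qed
  then have "card {f \<in> insert x S \<rightarrow>\<^sub>E T. inj_on f (insert x S)} = card (SIGMA g:?A. T - g ` S)"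
    by (simp add: bij_betw_same_card)
  also have "\<dots> = (\<Sum>g\<in>?A. card (T - g ` S))" using finA assms(2) by simp
  also have "\<dots> = (\<Sum>g\<in>?A. card T - card S)"
  proof (rule sum.cong)
    fix g assume "g \<in> ?A"
    then have "g ` S \<subseteq> T" "card (g ` S) = card S" by (auto simp: card_image)
    then show "card (T - g ` S) = card T - card S"
      using insert(1) by (simp add: card_Diff_subset)
  qed simp
  also have "\<dots> = fact (card S) * ((card T choose card S) * (card T - card S))"
    using insert.IH by simp
  \<comment> \<open>Both sides equal \<open>card T * ((card T - 1) choose card S)\<close>.\<close>
  also have "(card T choose card S) * (card T - card S) = Suc (card S) * (card T choose Suc (card S))"
    using binomial_absorb_comp[of "card T" "card S"] binomial_absorption[of "card S" "card T"]
    by (simp add: mult.commute)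
  finally show ?case using insert by (simp add: algebra_simps)
qed

text \<open>Indexing by the image of \<open>\<sigma>\<close>, instead of a whole codomain, keeps the
  empty set out, as a partition requires.\<close>

definition kernel_partition :: "'a set \<Rightarrow> ('a \<Rightarrow> 'b) \<Rightarrow> 'a set set" where
  "kernel_partition I \<sigma> = (\<lambda>j. {i \<in> I. \<sigma> i = j}) ` \<sigma> ` I"

lemma fibre_inj_on: "inj_on (\<lambda>j. {i \<in> I. \<sigma> i = j}) (\<sigma> ` I)"
  by (rule inj_onI) blast

lemma partition_on_kernel_partition: "partition_on I (kernel_partition I \<sigma>)"
  by (rule partition_onI) (auto simp: kernel_partition_def disjnt_def)

lemma card_kernel_partition: "card (kernel_partition I \<sigma>) = card (\<sigma> ` I)"
  unfolding kernel_partition_def by (rule card_image[OF fibre_inj_on])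

lemma prod_kernel_partition:
  "(\<Prod>X\<in>kernel_partition I \<sigma>. h X) = (\<Prod>j\<in>\<sigma> ` I. h {i \<in> I. \<sigma> i = j})"
  unfolding kernel_partition_def by (simp add: prod.reindex[OF fibre_inj_on])

lemma card_maps_with_kernel:
  assumes fin: "finite I" and P: "partition_on I P" and "finite T"
  shows "card {\<sigma> \<in> I \<rightarrow>\<^sub>E T. kernel_partition I \<sigma> = P} = fact (card P) * (card T choose card P)"
proof -
  have "\<forall>i\<in>I. \<exists>X. X \<in> P \<and> i \<in> X" using partition_onD1[OF P] by auto
  then obtain block where block: "\<And>i. i \<in> I \<Longrightarrow> block i \<in> P \<and> i \<in> block i" by metis
  have block_eq: "block i = X" if "X \<in> P" "i \<in> X" for i X
  proof -
    have "i \<in> I" using that partition_onD1[OF P] by auto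
    then have "block i \<in> P" "i \<in> block i" using block by auto
    then show ?thesis using that partition_onD2[OF P] by (auto dest: disjointD)
  qed
  have PI: "X \<subseteq> I" "X \<noteq> {}" if "X \<in> P" for X
    using that partition_onD1[OF P] partition_onD3[OF P] by auto
  let ?K = "{\<sigma> \<in> I \<rightarrow>\<^sub>E T. kernel_partition I \<sigma> = P}" and ?J = "{\<tau> \<in> P \<rightarrow>\<^sub>E T. inj_on \<tau> P}"
  \<comment> \<open>A map with kernel \<open>P\<close> is the same as an injection of the parts of \<open>P\<close>.\<close>
  let ?A = "\<lambda>\<tau>. \<lambda>i\<in>I. \<tau> (block i)" and ?B = "\<lambda>\<sigma>. \<lambda>X\<in>P. the_elem (\<sigma> ` X)"
  \<comment> \<open>\<open>\<sigma>\<close> is constant on each part, so \<open>the_elem\<close>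
    returns the value over which the part is the fibre. The second conjunct later places this value
    in \<open>T\<close>.\<close>
  have fib: "X = {i \<in> I. \<sigma> i = ?B \<sigma> X} \<and> ?B \<sigma> X \<in> \<sigma> ` I" if "kernel_partition I \<sigma> = P" "X \<in> P" for \<sigma> X
  proof -
    have "X \<in> (\<lambda>j. {i \<in> I. \<sigma> i = j}) ` \<sigma> ` I"
      using that by (simp add: kernel_partition_def)
    then obtain j where j: "j \<in> \<sigma> ` I" "X = {i \<in> I. \<sigma> i = j}" by (rule imageE)
    have "\<sigma> ` X = {j}" using j(1) unfolding j(2) by blast
    then have B: "?B \<sigma> X = j" using that(2) by simp
    show ?thesis unfolding B using j by blast
  qed
  have "bij_betw ?A ?J ?K"
  proof (rule bij_betwI[where g = ?B])
    show "?A \<in> ?J \<rightarrow> ?K"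
    proof
      fix \<tau> assume \<tau>: "\<tau> \<in> ?J"
      have im: "?A \<tau> ` I = \<tau> ` P"
      proof
        show "?A \<tau> ` I \<subseteq> \<tau> ` P" using block by auto
        show "\<tau> ` P \<subseteq> ?A \<tau> ` I"
        proof (rule image_subsetI)
          fix X assume X: "X \<in> P"
          then obtain i where "i \<in> X" "i \<in> I" using PI by blast
          then show "\<tau> X \<in> ?A \<tau> ` I" using block_eq[OF X] by (intro image_eqI[of _ _ i]) auto
        qed
      qed
      have fibre: "{i \<in> I. ?A \<tau> i = \<tau> X} = X" if X: "X \<in> P" for X
      proof -
        have "?A \<tau> i = \<tau> X \<longleftrightarrow> i \<in> X" if i: "i \<in> I" for i
        proof -
          have "\<tau> (block i) = \<tau> X \<longleftrightarrow> block i = X"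
            using \<tau> block[OF i] X by (auto dest: inj_onD)
          also have "\<dots> \<longleftrightarrow> i \<in> X" using block[OF i] block_eq[OF X] by blast
          finally show ?thesis using i by simp
        qed
        then show ?thesis using PI(1)[OF X] by blast
      qed
      have "kernel_partition I (?A \<tau>) = (\<lambda>X. X) ` P"
        unfolding kernel_partition_def im image_image using fibre by (rule image_cong[OF refl])
      moreover have "?A \<tau> \<in> I \<rightarrow>\<^sub>E T" using \<tau> block by (auto simp: restrict_PiE_iff)
      ultimately show "?A \<tau> \<in> ?K" by simp
    qed
    show "?B \<in> ?K \<rightarrow> ?J"
    proof
      fix \<sigma> assume \<sigma>: "\<sigma> \<in> ?K"
      have "?B \<sigma> X \<in> T" if "X \<in> P" for X using fib[of \<sigma> X] \<sigma> that by auto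
      moreover have "inj_on (?B \<sigma>) P"
      proof (rule inj_onI)
        fix X Y assume XY: "X \<in> P" "Y \<in> P" "?B \<sigma> X = ?B \<sigma> Y"
        have "X = {i \<in> I. \<sigma> i = ?B \<sigma> X}" "Y = {i \<in> I. \<sigma> i = ?B \<sigma> Y}"
          using fib \<sigma> XY(1,2) by blast+
        then show "X = Y" using XY(3) by simp
      qed
      ultimately show "?B \<sigma> \<in> ?J" by (simp add: restrict_PiE_iff)
    qed
    show "?B (?A \<tau>) = \<tau>" if "\<tau> \<in> ?J" for \<tau>
    proof (rule PiE_ext)
      show "\<tau> \<in> P \<rightarrow>\<^sub>E UNIV" using that by (auto simp: PiE_iff)
      fix X assume X: "X \<in> P"
      have "?A \<tau> ` X = (\<lambda>_. \<tau> X) ` X"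
        using PI(1)[OF X] block_eq[OF X] by (intro image_cong) auto
      also have "\<dots> = {\<tau> X}" using PI(2)[OF X] by auto
      finally show "?B (?A \<tau>) X = \<tau> X" using X by simp
    qed auto
    show "?A (?B \<sigma>) = \<sigma>" if \<sigma>: "\<sigma> \<in> ?K" for \<sigma>
    proof (rule PiE_ext)
      show "\<sigma> \<in> I \<rightarrow>\<^sub>E UNIV" using \<sigma> by (auto simp: PiE_iff)
      fix i assume i: "i \<in> I"
      then have "i \<in> {i' \<in> I. \<sigma> i' = ?B \<sigma> (block i)}" using fib[of \<sigma> "block i"] \<sigma> block[OF i] by blast
      then show "?A (?B \<sigma>) i = \<sigma> i" using i by simp
    qed auto
  qed
  then have "card ?K = card ?J" by (simp add: bij_betw_same_card)
  also have "\<dots> = fact (card P) * (card T choose card P)"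
    using finite_elements[OF fin P] \<open>finite T\<close> by (rule card_injections)
  finally show ?thesis .
qed

subsection \<open>Counting the endomorphisms of a given rank\<close>

theorem theorem1p3:
  fixes m n k :: nat
  assumes "n \<ge> 3 \<or> n = 2 \<and> k = 1"
    and "1 \<le> k" and "k \<le> m - 1"
  shows "card {f \<in> singular_endomorphisms (cube m n) (hamming_adj m).
                map_rank (cube m n) f = n ^ k} =
         (m choose k) * n ^ (m - k) * fact k *
         (\<Sum>P | partition_on {1..m} P \<and> card P = k. \<Prod>X\<in>P. num_LHC (card X) n)"
proof -
  let ?I = "{1..m}"
  let ?S = "{f \<in> singular_endomorphisms (cube m n) (hamming_adj m). map_rank (cube m n) f = n ^ k}"
  let ?\<Sigma> = "{\<sigma> \<in> ?I \<rightarrow>\<^sub>E ?I. card (\<sigma> ` ?I) = k}"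
  let ?Q = "{P. partition_on ?I P \<and> card P = k}"
  let ?h = "\<lambda>P. \<Prod>X\<in>P. num_LHC (card X) n"
  \<comment> \<open>\<open>m - 1\<close> is truncated subtraction; \<open>1 \<le> k\<close> rules
    out \<open>m = 0\<close>, which yields the strict bound.\<close>
  have n2: "n \<ge> 2" and km: "k < m" using assms by auto
  have pow: "n ^ a = n ^ b \<longleftrightarrow> a = b" for a b using n2 by (intro power_inject_exp) simp
  \<comment> \<open>A directed map has rank \<open>n\<close> to the size of the image of
    \<open>\<sigma>\<close>, so prescribing the rank amounts to prescribing that size.\<close>
  have "?S = (\<Union>\<sigma>\<in>?\<Sigma>. directed_maps ?I n \<sigma>)"
  proof (intro equalityI subsetI)
    fix f assume f: "f \<in> ?S"
    then have V: "f \<in> (?I \<rightarrow>\<^sub>E {..<n}) \<rightarrow>\<^sub>E (?I \<rightarrow>\<^sub>E {..<n})"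
      by (simp add: singular_endomorphisms_def endomorphisms_def cube_def)
    have adj: "\<exists>j. differ ?I (f u) (f v) = {j}"
      if "u \<in> ?I \<rightarrow>\<^sub>E {..<n}" "v \<in> ?I \<rightarrow>\<^sub>E {..<n}" "differ ?I u v = {i}" for u v i
      using f that unfolding singular_endomorphisms_def endomorphisms_def cube_def hamming_adj_iff by blast
    have rank: "card (f ` (?I \<rightarrow>\<^sub>E {..<n})) = n ^ k" using f by (simp add: map_rank_def cube_def)
    have "\<exists>\<sigma>\<in>?I \<rightarrow>\<^sub>E ?I. f \<in> directed_maps ?I n \<sigma>"
    proof (cases "n \<ge> 3")
      case True
      show ?thesis by (rule adjacency_preserving_directed[OF _ True V]) (simp, rule adj)
    next
      \<comment> \<open>What remains is \<open>n = 2\<close> and \<open>k = 1\<close>, where the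
        rank is 2.\<close>
      case False
      then have rank2: "card (f ` (?I \<rightarrow>\<^sub>E {..<n})) = 2" using rank assms(1) by auto
      have "1 \<in> ?I" using km by simp
      then show ?thesis using adj rank2 by (rule adjacency_preserving_rank_2_directed[OF n2 _ V])
    qed
    then obtain \<sigma> where \<sigma>: "\<sigma> \<in> ?I \<rightarrow>\<^sub>E ?I" "f \<in> directed_maps ?I n \<sigma>" by blast
    have "\<sigma> ` ?I \<subseteq> ?I" using \<sigma>(1) by blast
    then have "card (\<sigma> ` ?I) = k" using card_image_directed_map[OF _ _ _ \<sigma>(2)] n2 rank pow by simp
    then show "f \<in> (\<Union>\<sigma>\<in>?\<Sigma>. directed_maps ?I n \<sigma>)" using \<sigma> by blast
  next
    fix f assume "f \<in> (\<Union>\<sigma>\<in>?\<Sigma>. directed_maps ?I n \<sigma>)"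
    then obtain \<sigma> where \<sigma>: "\<sigma> \<in> ?I \<rightarrow>\<^sub>E ?I" "card (\<sigma> ` ?I) = k" and f: "f \<in> directed_maps ?I n \<sigma>"
      by blast
    have "\<sigma> ` ?I \<subseteq> ?I" using \<sigma>(1) by blast
    then have rank: "card (f ` cube m n) = n ^ k"
      using card_image_directed_map[OF _ _ _ f] n2 \<sigma>(2) by (simp add: cube_def)
    have "f \<in> endomorphisms (cube m n) (hamming_adj m)"
    proof -
      have "f \<in> (?I \<rightarrow>\<^sub>E {..<n}) \<rightarrow>\<^sub>E (?I \<rightarrow>\<^sub>E {..<n})" using f by (simp add: directed_maps_def)
      moreover have "\<exists>j. differ ?I (f u) (f v) = {j}"
        if "u \<in> ?I \<rightarrow>\<^sub>E {..<n}" "v \<in> ?I \<rightarrow>\<^sub>E {..<n}" "\<exists>i. differ ?I u v = {i}" for u v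
        using directed_mapsD[OF f that(1,2)] that(3) by metis
      ultimately show ?thesis unfolding endomorphisms_def cube_def hamming_adj_iff by simp
    qed
    \<comment> \<open>A bijection would have rank \<open>n ^ m\<close>, but
      \<open>k < m\<close>.\<close>
    moreover have "\<not> bij_betw f (cube m n) (cube m n)"
    proof
      assume "bij_betw f (cube m n) (cube m n)"
      then have "card (f ` cube m n) = n ^ m" by (simp add: bij_betw_def cube_def card_funcsetE)
      then show False using rank pow km by simp
    qed
    ultimately show "f \<in> ?S" using rank by (simp add: singular_endomorphisms_def map_rank_def)
  qed
  moreover have fin\<Sigma>: "finite ?\<Sigma>"
    by (rule finite_subset[of _ "?I \<rightarrow>\<^sub>E ?I"]) (auto intro: finite_PiE)
  have "card (\<Union>\<sigma>\<in>?\<Sigma>. directed_maps ?I n \<sigma>) = (\<Sum>\<sigma>\<in>?\<Sigma>. card (directed_maps ?I n \<sigma>))"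
  proof (rule card_UN_disjoint[OF fin\<Sigma>])
    have "finite ((?I \<rightarrow>\<^sub>E {..<n}) \<rightarrow>\<^sub>E (?I \<rightarrow>\<^sub>E {..<n}))" by (auto intro!: finite_PiE)
    then show "\<forall>\<sigma>\<in>?\<Sigma>. finite (directed_maps ?I n \<sigma>)" unfolding directed_maps_def by simp
    show "\<forall>\<sigma>\<in>?\<Sigma>. \<forall>\<tau>\<in>?\<Sigma>. \<sigma> \<noteq> \<tau> \<longrightarrow> directed_maps ?I n \<sigma> \<inter> directed_maps ?I n \<tau> = {}"
      using directed_maps_unique[OF n2] by blast
  qed
  moreover have "card (directed_maps ?I n \<sigma>) = n ^ (m - k) * ?h (kernel_partition ?I \<sigma>)"
    if "\<sigma> \<in> ?\<Sigma>" for \<sigma>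
  proof -
    have "\<sigma> ` ?I \<subseteq> ?I" using that by blast
    then show ?thesis
      using card_directed_maps[of ?I n \<sigma>] n2 that by (simp add: prod_kernel_partition)
  qed
  ultimately have "card ?S = (\<Sum>\<sigma>\<in>?\<Sigma>. n ^ (m - k) * ?h (kernel_partition ?I \<sigma>))"
    by simp
  \<comment> \<open>The maps \<open>\<sigma>\<close> are sorted by their partition into fibres, on
    which alone the summand depends.\<close>
  also have "\<dots> = (\<Sum>P\<in>?Q. \<Sum>\<sigma>\<in>{\<sigma>\<in>?\<Sigma>. kernel_partition ?I \<sigma> = P}. n ^ (m - k) * ?h (kernel_partition ?I \<sigma>))"
  proof (rule sum.group[OF fin\<Sigma>, symmetric])
    show "finite ?Q" by (rule finite_subset[OF _ finitely_many_partition_on[of ?I]]) auto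
    show "kernel_partition ?I ` ?\<Sigma> \<subseteq> ?Q"
      by (auto simp: partition_on_kernel_partition card_kernel_partition)
  qed
  also have "\<dots> = (\<Sum>P\<in>?Q. (fact k * (m choose k)) * (n ^ (m - k) * ?h P))"
  proof (rule sum.cong[OF refl])
    fix P assume P: "P \<in> ?Q"
    \<comment> \<open>A kernel with \<open>k\<close> parts already forces an image of size
      \<open>k\<close>.\<close>
    have "{\<sigma> \<in> ?\<Sigma>. kernel_partition ?I \<sigma> = P} = {\<sigma> \<in> ?I \<rightarrow>\<^sub>E ?I. kernel_partition ?I \<sigma> = P}"
      using P by (auto simp: card_kernel_partition)
    then have "card {\<sigma> \<in> ?\<Sigma>. kernel_partition ?I \<sigma> = P} = fact k * (m choose k)"
      using card_maps_with_kernel[of ?I P ?I] P by simp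
    then show "(\<Sum>\<sigma>\<in>{\<sigma>\<in>?\<Sigma>. kernel_partition ?I \<sigma> = P}. n ^ (m - k) * ?h (kernel_partition ?I \<sigma>)) =
        (fact k * (m choose k)) * (n ^ (m - k) * ?h P)"
      by simp
  qed
  also have "\<dots> = (m choose k) * n ^ (m - k) * fact k * (\<Sum>P\<in>?Q. ?h P)"
    by (simp add: sum_distrib_left mult_ac)
  finally show ?thesis .
qed

end
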